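(* Let $n$ be a positive integer. If $M_1$ and $M_2$ are submonoids of $T\mathfrak{S}_n$ containing $\mathfrak{S}_n$, then the union $M_1\cup M_2$ is also a submonoid of $T\mathfrak{S}_n$. Consequently, the submonoids of $T\mathfrak{S}_n$ containing $\mathfrak{S}_n$ form a distributive lattice under the operations of union and intersection.
   Context: Let $[n]=\{1,\ldots,n\}$ and let $\mathfrak{S}_n$ be the symmetric group of permutations of $[n]$ (product = composition). Let $\mathcal{P}_n$ be the set of set partitions of $[n]$ (collections of pairwise disjoint non-empty subsets, called blocks, with union $[n]$), ordered by refinement ($d\le e$ if every block of $d$ is contained in a block of $e$). It is a lattice, and it is regarded as a commutative idempotent monoid with product $de=d\vee e$ (the supremum, i.e. the finest set partition coarser than both $d$ and $e$); its identity is the partition into singletons. The group $\mathfrak{S}_n$ acts on $\mathcal{P}_n$ by applying permutations to blocks: $s\cdot\{I_1,\ldots,I_k\}=\{s(I_1),\ldots,s(I_k)\}$. The tied-symmetric monoid is the semidirect product $T\mathfrak{S}_n=\mathcal{P}_n\rtimes\mathfrak{S}_n$: its elements are uniquely written $es$ with $e\in\mathcal{P}_n$, $s\in\mathfrak{S}_n$, with multiplication $(es)(e's')=\bigl(e\,(s\cdot e')\bigr)(ss')$. Both $\mathcal{P}_n$ and $\mathfrak{S}_n$ are regarded as submonoids of $T\mathfrak{S}_n$ in the obvious way. *)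

theory Defs
  imports "HOL-Library.Disjoint_Sets" "HOL-Algebra.Sym_Groups" "HOL-Algebra.Lattice"
begin

section \<open>Set partitions\<close>

text \<open>\<^prop>\<open>refines A d e\<close> says that every block of \<open>d\<close> is contained in a block of \<open>e\<close>, so
  coarser partitions are larger and the join is the finest common coarsening.\<close>

definition set_partition_order :: "nat \<Rightarrow> nat set set gorder" where
  "set_partition_order n =
     \<lparr>carrier = {d. partition_on {1..n} d}, eq = (=), le = refines {1..n}\<rparr>"

definition set_partition_monoid :: "nat \<Rightarrow> nat set set monoid" where
  "set_partition_monoid n =
     \<lparr>carrier = carrier (set_partition_order n),
      mult = (\<lambda>d e. d \<squnion>\<^bsub>set_partition_order n\<^esub> e),
      one = (\<lambda>i. {i}) ` {1..n}\<rparr>"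

definition perm_act :: "(nat \<Rightarrow> nat) \<Rightarrow> nat set set \<Rightarrow> nat set set" where
  "perm_act s d = (\<lambda>I. s ` I) ` d"


section \<open>The tied-symmetric monoid\<close>

text \<open>The pair \<open>(e, s)\<close> stands for the element written \<open>es\<close>.\<close>

definition semidirect_product ::
    "('a, 'c) monoid_scheme \<Rightarrow> ('b, 'd) monoid_scheme \<Rightarrow> ('b \<Rightarrow> 'a \<Rightarrow> 'a) \<Rightarrow> ('a \<times> 'b) monoid" where
  "semidirect_product P S act =
     \<lparr>carrier = carrier P \<times> carrier S,
      mult = (\<lambda>(e, s) (e', s'). (e \<otimes>\<^bsub>P\<^esub> act s e', s \<otimes>\<^bsub>S\<^esub> s')),
      one = (\<one>\<^bsub>P\<^esub>, \<one>\<^bsub>S\<^esub>)\<rparr>"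

definition tied_symmetric_monoid :: "nat \<Rightarrow> (nat set set \<times> (nat \<Rightarrow> nat)) monoid" where
  "tied_symmetric_monoid n =
     semidirect_product (set_partition_monoid n) (sym_group n) perm_act"

text \<open>The symmetric group as a subset of the tied-symmetric monoid, via \<open>s \<mapsto> 1s\<close>.\<close>

definition embedded_sym :: "nat \<Rightarrow> (nat set set \<times> (nat \<Rightarrow> nat)) set" where
  "embedded_sym n = {\<one>\<^bsub>set_partition_monoid n\<^esub>} \<times> carrier (sym_group n)"


section \<open>Lattices of submonoids\<close>

locale distributive_lattice = lattice +
  assumes meet_join_distrib:
    "\<lbrakk>x \<in> carrier L; y \<in> carrier L; z \<in> carrier L\<rbrakk>
      \<Longrightarrow> x \<sqinter> (y \<squnion> z) = (x \<sqinter> y) \<squnion> (x \<sqinter> z)"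

definition submonoids_containing :: "('a, 'b) monoid_scheme \<Rightarrow> 'a set \<Rightarrow> 'a set gorder" where
  "submonoids_containing G H =
     \<lparr>carrier = {M. submonoid M G \<and> H \<subseteq> M}, eq = (=), le = (\<subseteq>)\<rparr>"


section \<open>Well-definedness\<close>

lemma set_partition_lattice: "lattice (set_partition_order n)"
proof -
  let ?A = "{1..n}"
  let ?L = "set_partition_order n"
  interpret partial_order ?L
    by unfold_locales
      (auto simp: set_partition_order_def intro: refines_refl refines_trans dest: refines_asym)
  show ?thesis
  proof
    fix x y assume xy: "x \<in> carrier ?L" "y \<in> carrier ?L"
    then have p: "partition_on ?A x" "partition_on ?A y"
      by (auto simp: set_partition_order_def)
    define U where "U = {u. refines ?A x u \<and> refines ?A y u}"
    have U: "partition_on ?A u" if "u \<in> U" for u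
      using that by (simp add: U_def refines_def)
    have top: "refines ?A d ({?A} - {{}})" if d: "partition_on ?A d" for d
      unfolding refines_def
    proof (intro conjI ballI d)
      show "partition_on ?A ({?A} - {{}})" by (auto simp: partition_on_def disjoint_def)
      fix I assume "I \<in> d"
      then have "I \<subseteq> ?A" "I \<noteq> {}" using d unfolding partition_on_def by blast+
      then show "\<exists>J\<in>{?A} - {{}}. I \<subseteq> J" by blast
    qed
    have ne: "U \<noteq> {}" unfolding U_def using top[OF p(1)] top[OF p(2)] by blast
    let ?s = "common_refinement U"
    have s: "refines ?A x ?s" "refines ?A y ?s"
      by (rule common_refinement_coarsest[OF U p(1) _ ne], simp, simp add: U_def)
        (rule common_refinement_coarsest[OF U p(2) _ ne], simp, simp add: U_def)
    have "least ?L ?s (Upper ?L {x, y})"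
    proof (rule least_UpperI)
      show "le ?L z ?s" if "z \<in> {x, y}" for z
        using that s by (auto simp: set_partition_order_def)
      show "le ?L ?s u" if "u \<in> Upper ?L {x, y}" for u
      proof -
        have "u \<in> U" using that xy by (simp add: U_def Upper_def set_partition_order_def)
        then show ?thesis
          using refines_common_refinement[OF U] by (simp add: set_partition_order_def)
      qed
      show "?s \<in> carrier ?L"
        using s(1) by (simp add: set_partition_order_def refines_def)
    qed (use xy in auto)
    then show "\<exists>s. least ?L s (Upper ?L {x, y})" ..
    let ?i = "common_refinement {x, y}"
    have P: "partition_on ?A u" if "u \<in> {x, y}" for u using that p by auto
    have "greatest ?L ?i (Lower ?L {x, y})"
    proof (rule greatest_LowerI)
      show "le ?L ?i z" if "z \<in> {x, y}" for z
        using refines_common_refinement[OF P that] by (simp add: set_partition_order_def)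
      show "le ?L u ?i" if "u \<in> Lower ?L {x, y}" for u
      proof -
        have u: "refines ?A u x" "refines ?A u y" "partition_on ?A u"
          using that xy by (auto simp: Lower_def set_partition_order_def)
        have "refines ?A u z" if "z \<in> {x, y}" for z using that u by auto
        from common_refinement_coarsest[of "{x, y}" ?A, OF P u(3) this] show ?thesis
          by (simp add: set_partition_order_def)
      qed
      show "?i \<in> carrier ?L"
        using partition_on_common_refinement[of "{x, y}" ?A, OF P] by (simp add: set_partition_order_def)
    qed (use xy in auto)
    then show "\<exists>s. greatest ?L s (Lower ?L {x, y})" ..
  qed
qed

lemma perm_act_refines:
  assumes "s permutes {1..n}" "refines {1..n} d e"
  shows "refines {1..n} (perm_act s d) (perm_act s e)"
proof -
  have part: "partition_on {1..n} (perm_act s d)" if "partition_on {1..n} d" for d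
  proof -
    have "\<Union> ((`) s ` d) = s ` \<Union> d" by blast
    also have "\<dots> = {1..n}"
      using that permutes_image[OF assms(1)] by (simp add: partition_on_def)
    finally show ?thesis
      using that permutes_inj[OF assms(1)] disjoint_image[of s d]
      by (auto simp: perm_act_def partition_on_def inj_on_def inj_def)
  qed
  show ?thesis
    unfolding refines_def
  proof (intro conjI ballI)
    show "partition_on {1..n} (perm_act s d)" "partition_on {1..n} (perm_act s e)"
      using assms(2) part by (simp_all add: refines_def)
    fix I assume "I \<in> perm_act s d"
    then obtain I' where I': "I' \<in> d" "I = s ` I'" by (auto simp: perm_act_def)
    with assms(2) obtain J where "J \<in> e" "I' \<subseteq> J" unfolding refines_def by blast
    then show "\<exists>J\<in>perm_act s e. I \<subseteq> J"
      unfolding perm_act_def I'(2) by (intro bexI[of _ "s ` J"] image_mono imageI)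
  qed
qed

lemma perm_act_compose: "perm_act (s \<circ> t) d = perm_act s (perm_act t d)"
  by (simp add: perm_act_def image_image image_comp)

lemma perm_act_id: "perm_act id d = d"
  by (simp add: perm_act_def)

lemma perm_act_closed:
  "s permutes {1..n} \<Longrightarrow> d \<in> carrier (set_partition_order n)
    \<Longrightarrow> perm_act s d \<in> carrier (set_partition_order n)"
  using perm_act_refines[of s n d d] by (auto simp: set_partition_order_def refines_def)

lemma perm_act_join:
  assumes s: "s permutes {1..n}"
    and d: "d \<in> carrier (set_partition_order n)" and e: "e \<in> carrier (set_partition_order n)"
  shows "perm_act s (d \<squnion>\<^bsub>set_partition_order n\<^esub> e)
    = perm_act s d \<squnion>\<^bsub>set_partition_order n\<^esub> perm_act s e"
proof -
  interpret lattice "set_partition_order n" by (rule set_partition_lattice)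
  have le: "le (set_partition_order n) = refines {1..n}" by (simp add: set_partition_order_def)
  let ?t = "Hilbert_Choice.inv s"
  let ?j = "perm_act s d \<squnion>\<^bsub>set_partition_order n\<^esub> perm_act s e"
  have t: "?t permutes {1..n}" using s by (rule permutes_inv)
  have ts: "perm_act ?t (perm_act s x) = x" and st: "perm_act s (perm_act ?t x) = x" for x
    using permutes_inv_o[OF s] by (simp_all flip: perm_act_compose add: perm_act_id)
  note cl = perm_act_closed[OF s] perm_act_closed[OF t]
  have 1: "refines {1..n} ?j (perm_act s (d \<squnion>\<^bsub>set_partition_order n\<^esub> e))"
    using join_le[of "perm_act s d" "perm_act s (d \<squnion>\<^bsub>set_partition_order n\<^esub> e)" "perm_act s e"]
      perm_act_refines[OF s] join_left[OF d e] join_right[OF d e] cl d e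
    by (simp add: le)
  have "refines {1..n} d (perm_act ?t ?j)" "refines {1..n} e (perm_act ?t ?j)"
    using perm_act_refines[OF t] join_left[of "perm_act s d" "perm_act s e"]
      join_right[of "perm_act s d" "perm_act s e"] cl d e ts
    by (metis le)+
  then have "refines {1..n} (d \<squnion>\<^bsub>set_partition_order n\<^esub> e) (perm_act ?t ?j)"
    using join_le[of d "perm_act ?t ?j" e] d e cl by (simp add: le)
  from perm_act_refines[OF s this] show ?thesis
    using 1 by (simp add: st refines_asym)
qed

lemma set_partition_comm_monoid: "comm_monoid (set_partition_monoid n)"
proof -
  let ?L = "set_partition_order n"
  interpret lattice ?L by (rule set_partition_lattice)
  have one: "(\<lambda>i. {i}) ` {1..n} \<in> carrier ?L"
    by (simp add: set_partition_order_def partition_on_singletons)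
  have bot: "le ?L ((\<lambda>i. {i}) ` {1..n}) x" if "x \<in> carrier ?L" for x
    using that partition_on_singletons[of "{1..n}"]
    by (auto simp: set_partition_order_def refines_def) (auto simp: partition_on_def)
  have unit: "(\<lambda>i. {i}) ` {1..n} \<squnion>\<^bsub>?L\<^esub> x = x" if "x \<in> carrier ?L" for x
    using le_iff_meet[OF one that] bot[OF that] by simp
  have assoc: "x \<squnion>\<^bsub>?L\<^esub> y \<squnion>\<^bsub>?L\<^esub> z = x \<squnion>\<^bsub>?L\<^esub> (y \<squnion>\<^bsub>?L\<^esub> z)"
    if "x \<in> carrier ?L" "y \<in> carrier ?L" "z \<in> carrier ?L" for x y z
    using weak_join_assoc[OF that] by (simp add: set_partition_order_def)
  show ?thesis
    by (rule comm_monoidI; simp only: set_partition_monoid_def partial_object.simps monoid.simps)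
      (rule join_comm | fact join_closed one assoc unit)+
qed

lemma perm_act_one:
  assumes "s \<in> carrier (sym_group n)"
  shows "perm_act s \<one>\<^bsub>set_partition_monoid n\<^esub> = \<one>\<^bsub>set_partition_monoid n\<^esub>"
proof -
  have s: "s permutes {1..n}" using assms by (simp add: sym_group_def)
  have "perm_act s ((\<lambda>i. {i}) ` {1..n}) = (\<lambda>i. {i}) ` (s ` {1..n})"
    by (simp only: perm_act_def image_image image_insert image_empty)
  then show ?thesis
    by (simp only: permutes_image[OF s] set_partition_monoid_def monoid.simps)
qed

lemma tied_symmetric_monoid: "monoid (tied_symmetric_monoid n)"
proof -
  interpret P: comm_monoid "set_partition_monoid n" by (rule set_partition_comm_monoid)
  interpret S: group "sym_group n" by (rule sym_group_is_group)
  have act_closed: "perm_act s d \<in> carrier (set_partition_monoid n)"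
    if "s \<in> carrier (sym_group n)" "d \<in> carrier (set_partition_monoid n)" for s d
    using that perm_act_closed by (auto simp: set_partition_monoid_def sym_group_def)
  have act_mult: "perm_act s (d \<otimes>\<^bsub>set_partition_monoid n\<^esub> e)
      = perm_act s d \<otimes>\<^bsub>set_partition_monoid n\<^esub> perm_act s e"
    if "s \<in> carrier (sym_group n)" "d \<in> carrier (set_partition_monoid n)"
      "e \<in> carrier (set_partition_monoid n)" for s d e
    using that perm_act_join by (auto simp: set_partition_monoid_def sym_group_def)
  have act_comp: "perm_act (s \<otimes>\<^bsub>sym_group n\<^esub> t) d = perm_act s (perm_act t d)" for s t d
    by (simp add: sym_group_def perm_act_compose)
  have act_id: "perm_act \<one>\<^bsub>sym_group n\<^esub> d = d" for d
    by (simp add: sym_group_def perm_act_id)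
  show ?thesis
    by (rule monoidI)
      (auto simp: tied_symmetric_monoid_def semidirect_product_def act_closed act_mult perm_act_one
        act_comp act_id P.m_assoc S.m_assoc)
qed

lemma embedded_sym_submonoid: "submonoid (embedded_sym n) (tied_symmetric_monoid n)"
proof -
  interpret P: comm_monoid "set_partition_monoid n" by (rule set_partition_comm_monoid)
  interpret S: group "sym_group n" by (rule sym_group_is_group)
  show ?thesis
    by unfold_locales
      (auto simp: embedded_sym_def tied_symmetric_monoid_def semidirect_product_def perm_act_one)
qed

end

theory Submission
  imports Defs
begin

text \<open>
  A submonoid \<open>M\<close> of the tied-symmetric monoid that contains the symmetric group is determined by
  its set \<open>E\<close> of set partitions: \<open>M = E \<times> \<SS>\<^sub>n\<close>, where \<open>E\<close> contains the partition into singletons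
  and is closed under joins and under the action of the symmetric group. The product of \<open>(d, s)\<close>
  and \<open>(e, t)\<close> has partition component \<open>d \<squnion> s e\<close>, so the union of two submonoids is a submonoid as
  soon as the following holds: if \<open>d \<in> E\<^sub>1\<close> and \<open>e \<in> E\<^sub>2\<close>, then \<open>f = d \<squnion> e\<close> lies in \<open>E\<^sub>1\<close> or \<open>E\<^sub>2\<close>.

  Now \<open>f\<close> is a join of conjugates of \<open>e\<close> whenever each non-singleton block \<open>F\<close> of \<open>f\<close> admits a
  conjugate of \<open>e\<close> that refines \<open>f\<close> and joins some two points of \<open>F\<close>: permuting \<open>F\<close> then produces
  conjugates that join any two points of \<open>F\<close> (\<open>mem_if_no_block_shattered\<close>). The partition \<open>e\<close> is itself such
  a conjugate unless it shatters \<open>F\<close>, that is, splits it into singletons. The same holds for \<open>d\<close>.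
  From here on, only non-singleton blocks of \<open>f\<close> matter. Because \<open>f\<close> is the join, a block of \<open>f\<close> shattered by \<open>d\<close> is a block of \<open>e\<close>
  (\<open>shattered_block_in_other\<close>). So if \<open>e\<close> shatters \<open>F\<close> and \<open>d\<close> shatters a block \<open>F\<^sub>0\<close> with
  \<open>|F\<^sub>0| \<le> |F|\<close>, then exchanging \<open>F\<^sub>0\<close> with a subset of \<open>F\<close> turns \<open>e\<close> into a conjugate that still
  refines \<open>f\<close> and is no longer trivial on \<open>F\<close> (\<open>conjugate_not_shattering\<close>). Hence \<open>f \<in> E\<^sub>2\<close> if every
  block shattered by \<open>e\<close> is at least as large as some block shattered by \<open>d\<close>. If that fails, then
  some block shattered by \<open>e\<close> is smaller than all blocks shattered by \<open>d\<close>, and \<open>f \<in> E\<^sub>1\<close> by symmetry.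
\<close>


section \<open>Lattices of sets\<close>

lemma lattice_of_sets:
  fixes \<F> :: "'a set set"
  defines "L \<equiv> \<lparr>carrier = \<F>, eq = (=), le = (\<subseteq>)\<rparr>"
  assumes Un: "\<And>A B. A \<in> \<F> \<Longrightarrow> B \<in> \<F> \<Longrightarrow> A \<union> B \<in> \<F>"
    and Int: "\<And>A B. A \<in> \<F> \<Longrightarrow> B \<in> \<F> \<Longrightarrow> A \<inter> B \<in> \<F>"
  shows "distributive_lattice L"
    and "A \<in> \<F> \<Longrightarrow> B \<in> \<F> \<Longrightarrow> A \<squnion>\<^bsub>L\<^esub> B = A \<union> B"
    and "A \<in> \<F> \<Longrightarrow> B \<in> \<F> \<Longrightarrow> A \<sqinter>\<^bsub>L\<^esub> B = A \<inter> B"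
proof -
  have sel [simp]: "carrier L = \<F>" "le L = (\<subseteq>)" "eq L = (=)" by (simp_all add: L_def)
  interpret partial_order L by unfold_locales auto
  have lat: "lattice L"
  proof
    fix A B assume AB: "A \<in> carrier L" "B \<in> carrier L"
    have "least L (A \<union> B) (Upper L {A, B})"
      by (rule least_UpperI) (use AB Un in \<open>auto simp: Upper_def\<close>)
    then show "\<exists>s. least L s (Upper L {A, B})" ..
    have "greatest L (A \<inter> B) (Lower L {A, B})"
      by (rule greatest_LowerI) (use AB Int in \<open>auto simp: Lower_def\<close>)
    then show "\<exists>s. greatest L s (Lower L {A, B})" ..
  qed
  interpret lattice L by (rule lat)
  show join: "A \<squnion>\<^bsub>L\<^esub> B = A \<union> B" if "A \<in> \<F>" "B \<in> \<F>" for A B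
    using that join_left[of A B] join_right[of A B] join_le[of A "A \<union> B" B] Un by auto
  show meet: "A \<sqinter>\<^bsub>L\<^esub> B = A \<inter> B" if "A \<in> \<F>" "B \<in> \<F>" for A B
    using that meet_left[of A B] meet_right[of A B] meet_le[of "A \<inter> B" A B] Int by auto
  show "distributive_lattice L"
    by unfold_locales (use Un Int in \<open>auto simp: join meet\<close>)
qed


section \<open>Joins of conjugates of a set partition\<close>

definition join_invariant :: "nat \<Rightarrow> nat set set set \<Rightarrow> bool" where
  "join_invariant n E \<longleftrightarrow>
     E \<subseteq> carrier (set_partition_order n) \<and>
     (\<forall>d\<in>E. \<forall>e\<in>E. d \<squnion>\<^bsub>set_partition_order n\<^esub> e \<in> E) \<and>
     (\<forall>s d. s permutes {1..n} \<longrightarrow> d \<in> E \<longrightarrow> perm_act s d \<in> E)"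

definition shattered :: "'a set set \<Rightarrow> 'a set \<Rightarrow> bool" where
  "shattered d F \<longleftrightarrow> (\<forall>x\<in>F. {x} \<in> d)"

lemma set_partition_order_sel:
  "carrier (set_partition_order n) = {d. partition_on {1..n} d}"
  "le (set_partition_order n) = refines {1..n}"
  by (simp_all add: set_partition_order_def)

lemma partition_on_same_block:
  "partition_on A d \<Longrightarrow> I \<in> d \<Longrightarrow> J \<in> d \<Longrightarrow> x \<in> I \<Longrightarrow> x \<in> J \<Longrightarrow> I = J"
  by (auto simp: partition_on_def disjoint_def)

text \<open>The witness is the join of \<open>e\<close> with all members of \<open>D\<close>.\<close>

lemma join_invariant_upper_bound:
  assumes E: "join_invariant n E" and "e \<in> E" "refines {1..n} e f"
    and "finite D" "\<forall>d\<in>D. d \<in> E \<and> refines {1..n} d f"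
  shows "\<exists>g\<in>E. refines {1..n} g f \<and> (\<forall>d\<in>D. refines {1..n} d g)"
  using assms(4,5)
proof (induction D rule: finite_induct)
  case empty
  then show ?case using assms(2,3) by blast
next
  case (insert d D)
  interpret lattice "set_partition_order n" by (rule set_partition_lattice)
  obtain g where g: "g \<in> E" "refines {1..n} g f" "\<forall>d\<in>D. refines {1..n} d g"
    using insert by blast
  have d: "d \<in> E" "refines {1..n} d f" using insert by auto
  have parts: "partition_on {1..n} d" "partition_on {1..n} g" "partition_on {1..n} f"
    using d g by (auto simp: refines_def)
  let ?h = "d \<squnion>\<^bsub>set_partition_order n\<^esub> g"
  have "?h \<in> E" using E d(1) g(1) by (auto simp: join_invariant_def)
  moreover have "refines {1..n} ?h f"
    using join_le[of d f g] parts d g by (simp add: set_partition_order_sel)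
  moreover have "refines {1..n} d ?h" "refines {1..n} g ?h"
    using join_left[of d g] join_right[of d g] parts by (simp_all add: set_partition_order_sel)
  ultimately show ?case using g(3) refines_trans by blast
qed

text \<open>Two transpositions inside the block \<open>F\<close> move one given pair of points to another.\<close>

lemma conjugate_joining_pair:
  assumes g: "refines {1..n} g f" and F: "F \<in> f"
    and not_shattered: "\<not> shattered g F" and ab: "a \<in> F" "b \<in> F" "a \<noteq> b"
  shows "\<exists>s. s permutes {1..n} \<and> refines {1..n} (perm_act s g) f \<and>
    (\<exists>I\<in>perm_act s g. a \<in> I \<and> b \<in> I)"
proof -
  have pg: "partition_on {1..n} g" and pf: "partition_on {1..n} f"
    using g by (auto simp: refines_def)
  have FA: "F \<subseteq> {1..n}" using pf F by (auto simp: partition_on_def)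
  obtain x where x: "x \<in> F" "{x} \<notin> g" using not_shattered by (auto simp: shattered_def)
  obtain I where I: "I \<in> g" "x \<in> I" using pg x FA by (auto simp: partition_on_def)
  have "I \<noteq> {x}" using I x by blast
  then obtain y where y: "y \<in> I" "y \<noteq> x" using I(2) by blast
  obtain J where "J \<in> f" "I \<subseteq> J" using g I by (auto simp: refines_def)
  then have IF: "I \<subseteq> F" using partition_on_same_block[OF pf _ F _ x(1)] I by blast
  define y' where "y' = transpose x a y"
  define s where "s = transpose y' b \<circ> transpose x a"
  have y': "y' \<in> F" "y' \<noteq> a"
    using y IF x ab by (auto simp: y'_def transpose_def)
  have sF: "s permutes F"
    unfolding s_def by (intro permutes_compose permutes_swap_id x ab y')
  then have s: "s permutes {1..n}" using FA by (rule permutes_subset)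
  have sx: "s x = a" and sy: "s y = b"
    using y' ab by (auto simp: s_def y'_def[symmetric])
  have "s ` K = K" if "K \<in> f" for K
  proof (cases "K = F")
    case True
    then show ?thesis using permutes_image[OF sF] by simp
  next
    case False
    then have "K \<inter> F = {}" using pf F that by (auto simp: partition_on_def disjoint_def)
    then have "s z = z" if "z \<in> K" for z using permutes_not_in[OF sF] that by blast
    then show ?thesis by simp
  qed
  then have "perm_act s f = f" by (simp add: perm_act_def)
  then have "refines {1..n} (perm_act s g) f" using perm_act_refines[OF s g] by simp
  moreover have "s ` I \<in> perm_act s g" "a \<in> s ` I" "b \<in> s ` I"
    using I y sx sy by (auto simp: perm_act_def)
  ultimately show ?thesis using s by blast
qed

text \<open>The join of all conjugates of \<open>e\<close> below \<open>f\<close> lies in \<open>E\<close>, and the hypothesis makes it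
  connect any two points of a block of \<open>f\<close>, so it is \<open>f\<close>.\<close>

lemma mem_if_no_block_shattered:
  assumes E: "join_invariant n E" and e: "e \<in> E" "refines {1..n} e f"
    and conj: "\<And>F. F \<in> f \<Longrightarrow> \<not> is_singleton F \<Longrightarrow>
      \<exists>s. s permutes {1..n} \<and> refines {1..n} (perm_act s e) f \<and> \<not> shattered (perm_act s e) F"
  shows "f \<in> E"
proof -
  have pf: "partition_on {1..n} f" using e by (simp add: refines_def)
  define D where "D = {d \<in> E. refines {1..n} d f}"
  have "D \<subseteq> Pow (Pow {1..n})" unfolding D_def refines_def partition_on_def by blast
  then have "finite D" by (rule finite_subset) simp
  then obtain g where g: "g \<in> E" "refines {1..n} g f" "\<forall>d\<in>D. refines {1..n} d g"
    using join_invariant_upper_bound[OF E e, of D] unfolding D_def by blast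
  have pg: "partition_on {1..n} g" using g by (simp add: refines_def)
  have joined: "\<exists>J\<in>g. a \<in> J \<and> b \<in> J" if F: "F \<in> f" and ab: "a \<in> F" "b \<in> F" for F a b
  proof (cases "a = b")
    case True
    have "a \<in> {1..n}" using pf F ab unfolding partition_on_def by blast
    then show ?thesis using pg True unfolding partition_on_def by blast
  next
    case False
    then have "\<not> is_singleton F" using ab by (auto simp: is_singleton_def)
    then obtain s where s: "s permutes {1..n}" "refines {1..n} (perm_act s e) f"
      "\<not> shattered (perm_act s e) F" using conj F by blast
    obtain t I where t: "t permutes {1..n}" "refines {1..n} (perm_act t (perm_act s e)) f"
      and I: "I \<in> perm_act t (perm_act s e)" "a \<in> I" "b \<in> I"
      using conjugate_joining_pair[OF s(2) F s(3) ab False] by blast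
    have "perm_act t (perm_act s e) \<in> D"
      using t s(1) E e(1) by (auto simp: D_def join_invariant_def)
    then have "refines {1..n} (perm_act t (perm_act s e)) g" using g by blast
    then obtain J where "J \<in> g" "I \<subseteq> J" using I unfolding refines_def by blast
    then show ?thesis using I by blast
  qed
  have "refines {1..n} f g"
    unfolding refines_def
  proof (intro conjI ballI pf pg)
    fix F assume F: "F \<in> f"
    then have "F \<noteq> {}" using pf unfolding partition_on_def by blast
    then obtain a where a: "a \<in> F" by blast
    obtain J where J: "J \<in> g" "a \<in> J" using joined[OF F a a] by blast
    have "F \<subseteq> J" using joined[OF F a] partition_on_same_block[OF pg _ J(1) _ J(2)] by blast
    then show "\<exists>J\<in>g. F \<subseteq> J" using J by blast
  qed
  then have "f = g" using g(2) by (rule refines_asym)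
  then show ?thesis using g(1) by simp
qed


section \<open>Shattered blocks of a join\<close>

text \<open>Replacing \<open>F\<close> in the join by the blocks of \<open>e\<close> inside \<open>F\<close> gives another upper bound of \<open>d\<close>
  and \<open>e\<close>. As the join is the least one, \<open>F\<close> is a single block of \<open>e\<close>.\<close>

lemma shattered_block_in_other:
  assumes d: "partition_on {1..n} d" and e: "partition_on {1..n} e"
    and F: "F \<in> d \<squnion>\<^bsub>set_partition_order n\<^esub> e" and shattered: "shattered d F"
  shows "F \<in> e"
proof -
  interpret lattice "set_partition_order n" by (rule set_partition_lattice)
  define f where "f = d \<squnion>\<^bsub>set_partition_order n\<^esub> e"
  have df: "refines {1..n} d f" and ef: "refines {1..n} e f"
    using join_left[of d e] join_right[of d e] d e by (simp_all add: set_partition_order_sel f_def)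
  then have pf: "partition_on {1..n} f" by (simp add: refines_def)
  have F: "F \<in> f" using assms(3) by (simp add: f_def)
  have sub: "I \<subseteq> F" if h: "refines {1..n} h f" "I \<in> h" and x: "x \<in> I" "x \<in> F" for h I x
  proof -
    obtain J where "J \<in> f" "I \<subseteq> J" using h unfolding refines_def by blast
    then show ?thesis using partition_on_same_block[OF pf _ F _ x(2)] x(1) by blast
  qed
  define eF where "eF = {I \<in> e. I \<subseteq> F}"
  define u where "u = (f - {F}) \<union> eF"
  have Union_eF: "\<Union> eF = F"
  proof
    show "F \<subseteq> \<Union> eF"
    proof
      fix x assume x: "x \<in> F"
      then have "x \<in> {1..n}" using pf F unfolding partition_on_def by blast
      then obtain I where "I \<in> e" "x \<in> I" using e unfolding partition_on_def by blast
      then show "x \<in> \<Union> eF" using sub[OF ef _ _ x] by (auto simp: eF_def)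
    qed
  qed (auto simp: eF_def)
  have pu: "partition_on {1..n} u"
  proof (rule partition_onI)
    have "\<Union> u = \<Union> (f - {F}) \<union> F" using Union_eF by (simp add: u_def)
    also have "\<dots> = \<Union> f" using F by blast
    finally show "\<Union> u = {1..n}" using pf by (simp add: partition_on_def)
    show "{} \<notin> u"
      using pf e by (auto simp: u_def eF_def partition_on_def)
    have dis: "I \<inter> J = {}" if "I \<in> f - {F}" "J \<in> eF" for I J
      using that partition_on_same_block[OF pf _ F, of I] unfolding eF_def by blast
    show "disjnt p q" if "p \<in> u" "q \<in> u" "p \<noteq> q" for p q
      using that dis[of p q] dis[of q p] partition_on_same_block[OF pf, of p q]
        partition_on_same_block[OF e, of p q]
      unfolding u_def disjnt_def eF_def by blast
  qed
  have block: "\<exists>J\<in>u. I \<subseteq> J" if h: "refines {1..n} h f" "I \<in> h" and dis: "I \<inter> F = {}" for h I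
  proof -
    obtain J where J: "J \<in> f" "I \<subseteq> J" using h unfolding refines_def by blast
    moreover have "I \<noteq> {}" using h unfolding refines_def partition_on_def by blast
    ultimately show ?thesis using dis by (auto simp: u_def)
  qed
  have "refines {1..n} e u"
    unfolding refines_def
  proof (intro conjI ballI e pu)
    fix I assume I: "I \<in> e"
    show "\<exists>J\<in>u. I \<subseteq> J"
    proof (cases "I \<inter> F = {}")
      case False
      then have "I \<in> u" using sub[OF ef I] I by (auto simp: u_def eF_def)
      then show ?thesis by blast
    qed (use block ef I in blast)
  qed
  moreover have "refines {1..n} d u"
    unfolding refines_def
  proof (intro conjI ballI d pu)
    fix I assume I: "I \<in> d"
    show "\<exists>J\<in>u. I \<subseteq> J"
    proof (cases "I \<inter> F = {}")
      case False
      then obtain x where x: "x \<in> I" "x \<in> F" by blast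
      then have "I = {x}"
        using shattered partition_on_same_block[OF d I] by (auto simp: shattered_def)
      moreover obtain J where "J \<in> eF" "x \<in> J" using x Union_eF by blast
      ultimately show ?thesis by (auto simp: u_def)
    qed (use block df I in blast)
  qed
  ultimately have "refines {1..n} f u"
    using join_le[of d u e] d e pu by (simp add: set_partition_order_sel f_def)
  then obtain J where J: "J \<in> u" "F \<subseteq> J" using F by (auto simp: refines_def)
  have "F \<noteq> {}" using pf F by (auto simp: partition_on_def)
  then have "J \<in> eF" using J F partition_on_same_block[OF pf _ F] by (auto simp: u_def)
  then have "J = F" "J \<in> e" using J by (auto simp: eF_def)
  then show ?thesis by simp
qed

lemma exchange_permutation:
  assumes "finite A" "finite B" "A \<inter> B = {}" "card A \<le> card B"
  shows "\<exists>s. s permutes (A \<union> B) \<and> s ` A \<subseteq> B"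
proof -
  obtain h where h: "inj_on h A" "h ` A \<subseteq> B"
    using card_le_inj[OF assms(1,2,4)] by blast
  define s where "s x = (if x \<in> A then h x else if x \<in> h ` A then inv_into A h x else x)" for x
  have s_A: "s x = h x" if "x \<in> A" for x
    using that by (simp add: s_def)
  have s_h: "s (h x) = x" if x: "x \<in> A" for x
  proof -
    have "h x \<notin> A" using x h assms(3) by blast
    then show ?thesis using x h by (simp add: s_def inv_into_f_f)
  qed
  have s_other: "s x = x" if "x \<notin> A" "x \<notin> h ` A" for x
    using that by (simp add: s_def)
  have ss: "s (s x) = x" for x
  proof -
    consider "x \<in> A" | y where "y \<in> A" "x = h y" | "x \<notin> A" "x \<notin> h ` A" by blast
    then show ?thesis by cases (simp_all add: s_A s_h s_other)
  qed
  have "s x = x" if "x \<notin> A \<union> B" for x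
    using that h by (intro s_other) blast+
  moreover have "\<exists>!x. s x = y" for y
    using ss by (intro ex1I[of _ "s y"]) auto
  ultimately have "s permutes (A \<union> B)" unfolding permutes_def by blast
  moreover have "s ` A \<subseteq> B" using h s_A by auto
  ultimately show ?thesis by blast
qed

text \<open>Exchange \<open>F\<^sub>0\<close> with a subset of \<open>F\<close>: the block \<open>F\<^sub>0\<close> moves into \<open>F\<close>, singletons of \<open>F\<close> move to
  singletons, and all other blocks of \<open>e\<close> stay in place.\<close>

lemma conjugate_not_shattering:
  assumes ef: "refines {1..n} e f" and F: "F \<in> f" "shattered e F"
    and F0: "F0 \<in> f" "F0 \<in> e" "\<not> is_singleton F0" and card: "card F0 \<le> card F"
  shows "\<exists>s. s permutes {1..n} \<and> refines {1..n} (perm_act s e) f \<and> \<not> shattered (perm_act s e) F"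
proof -
  have pe: "partition_on {1..n} e" and pf: "partition_on {1..n} f"
    using ef by (auto simp: refines_def)
  have sub: "F \<subseteq> {1..n}" "F0 \<subseteq> {1..n}" using pf F F0 by (auto simp: partition_on_def)
  then have fin: "finite F" "finite F0" using finite_subset by blast+
  have ne: "F0 \<noteq> {}" using pf F0 by (auto simp: partition_on_def)
  have single: "I = {x}" if "I \<in> e" "x \<in> I" "x \<in> F" for I x
    using that F(2) partition_on_same_block[OF pe that(1)] by (auto simp: shattered_def)
  have "F0 \<noteq> F" using single[OF F0(2)] ne F0(3) by (auto simp: is_singleton_def)
  then have "F0 \<inter> F = {}" using pf F F0 by (auto simp: partition_on_def disjoint_def)
  then obtain s where s: "s permutes (F0 \<union> F)" and sF0: "s ` F0 \<subseteq> F"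
    using exchange_permutation[OF fin(2,1)] card by blast
  have sn: "s permutes {1..n}" using permutes_subset[OF s] sub by simp
  have p: "partition_on {1..n} (perm_act s e)"
    using perm_act_refines[OF sn refines_refl[OF pe]] by (simp add: refines_def)
  have "refines {1..n} (perm_act s e) f"
    unfolding refines_def
  proof (intro conjI ballI p pf)
    fix K assume "K \<in> perm_act s e"
    then obtain I where I: "I \<in> e" "K = s ` I" by (auto simp: perm_act_def)
    consider "I = F0" | x where "x \<in> I" "x \<in> F" | "I \<noteq> F0" "I \<inter> F = {}" by blast
    then show "\<exists>J\<in>f. K \<subseteq> J"
    proof cases
      case 1
      then show ?thesis using sF0 F(1) I by blast
    next
      case 2
      then have "I = {x}" using single I by blast
      moreover have "s x \<in> {1..n}" using 2 sub permutes_in_image[OF sn] by blast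
      ultimately show ?thesis using I pf by (auto simp: partition_on_def)
    next
      case 3
      then have "I \<inter> (F0 \<union> F) = {}" using partition_on_same_block[OF pe I(1) F0(2)] by blast
      then have "s z = z" if "z \<in> I" for z using permutes_not_in[OF s] that by blast
      then have "K = I" using I by simp
      then show ?thesis using I ef by (auto simp: refines_def)
    qed
  qed
  moreover have "\<not> shattered (perm_act s e) F"
  proof
    assume sh: "shattered (perm_act s e) F"
    obtain x where x: "x \<in> F0" using ne by blast
    then have "{s x} \<in> perm_act s e" using sh sF0 by (auto simp: shattered_def)
    moreover have "s ` F0 \<in> perm_act s e" using F0 by (auto simp: perm_act_def)
    ultimately have "s ` F0 = {s x}" using partition_on_same_block[OF p] x by blast
    then have "F0 = {x}" using x permutes_inj[OF s] by (auto simp: inj_def)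
    then show False using F0(3) by (simp add: is_singleton_def)
  qed
  ultimately show ?thesis using sn by blast
qed

lemma join_mem_if_smaller_shattered:
  assumes E: "join_invariant n E" and e: "e \<in> E" and d: "partition_on {1..n} d"
  defines "f \<equiv> d \<squnion>\<^bsub>set_partition_order n\<^esub> e"
  assumes smaller: "\<And>F. F \<in> f \<Longrightarrow> \<not> is_singleton F \<Longrightarrow> shattered e F \<Longrightarrow>
      \<exists>F0\<in>f. \<not> is_singleton F0 \<and> shattered d F0 \<and> card F0 \<le> card F"
  shows "f \<in> E"
proof -
  interpret lattice "set_partition_order n" by (rule set_partition_lattice)
  have pe: "partition_on {1..n} e"
    using E e by (auto simp: join_invariant_def set_partition_order_sel)
  have ef: "refines {1..n} e f"
    using join_right[of d e] d pe by (simp add: set_partition_order_sel f_def)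
  show ?thesis
  proof (rule mem_if_no_block_shattered[OF E e ef])
    fix F assume F: "F \<in> f" "\<not> is_singleton F"
    show "\<exists>s. s permutes {1..n} \<and> refines {1..n} (perm_act s e) f \<and> \<not> shattered (perm_act s e) F"
    proof (cases "shattered e F")
      case True
      then obtain F0 where F0: "F0 \<in> f" "\<not> is_singleton F0" "shattered d F0" "card F0 \<le> card F"
        using smaller F by blast
      have "F0 \<in> e"
        using shattered_block_in_other[OF d pe _ F0(3)] F0(1) by (simp add: f_def)
      then show ?thesis using conjugate_not_shattering[OF ef F(1) True F0(1) _ F0(2,4)] by blast
    next
      case False
      then show ?thesis using ef permutes_id[of "{1..n}"] by (metis perm_act_id)
    qed
  qed
qed

text \<open>Consider the smallest non-singleton block of the join shattered by \<open>d\<close> or \<open>e\<close>: it bounds from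
  below the blocks shattered by the other one, which is the one whose conjugates generate the join.
  If nothing is shattered, either set contains the join.\<close>

lemma join_mem_Un:
  assumes E1: "join_invariant n E1" and E2: "join_invariant n E2" and "d \<in> E1" "e \<in> E2"
  shows "d \<squnion>\<^bsub>set_partition_order n\<^esub> e \<in> E1 \<union> E2"
proof -
  interpret lattice "set_partition_order n" by (rule set_partition_lattice)
  have p: "partition_on {1..n} d" "partition_on {1..n} e"
    using assms by (auto simp: join_invariant_def set_partition_order_sel)
  let ?f = "d \<squnion>\<^bsub>set_partition_order n\<^esub> e"
  have comm: "e \<squnion>\<^bsub>set_partition_order n\<^esub> d = ?f" by (rule join_comm)
  define S where "S h = {F \<in> ?f. \<not> is_singleton F \<and> shattered h F}" for h
  consider "\<forall>F\<in>S e. \<exists>F0\<in>S d. card F0 \<le> card F" | "\<forall>F\<in>S d. \<exists>F0\<in>S e. card F0 \<le> card F"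
    by (metis linorder_le_cases)
  then show ?thesis
  proof cases
    case 1
    then have "?f \<in> E2"
      by (intro join_mem_if_smaller_shattered[OF E2 assms(4) p(1)]) (auto simp: S_def)
    then show ?thesis by blast
  next
    case 2
    then have "e \<squnion>\<^bsub>set_partition_order n\<^esub> d \<in> E1"
      by (intro join_mem_if_smaller_shattered[OF E1 assms(3) p(2)]) (auto simp: S_def comm)
    then show ?thesis by (simp add: comm)
  qed
qed


section \<open>Submonoids containing the symmetric group\<close>

lemma tied_symmetric_monoid_sel:
  "carrier (tied_symmetric_monoid n) =
     carrier (set_partition_order n) \<times> {s. s permutes {1..n}}"
  "(d, s) \<otimes>\<^bsub>tied_symmetric_monoid n\<^esub> (e, t) =
     (d \<squnion>\<^bsub>set_partition_order n\<^esub> perm_act s e, s \<circ> t)"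
  "\<one>\<^bsub>tied_symmetric_monoid n\<^esub> = (\<one>\<^bsub>set_partition_monoid n\<^esub>, id)"
  by (simp_all add: tied_symmetric_monoid_def semidirect_product_def set_partition_monoid_def
      sym_group_def)

lemma one_join:
  assumes "d \<in> carrier (set_partition_order n)"
  shows "\<one>\<^bsub>set_partition_monoid n\<^esub> \<squnion>\<^bsub>set_partition_order n\<^esub> d = d"
    and "d \<squnion>\<^bsub>set_partition_order n\<^esub> \<one>\<^bsub>set_partition_monoid n\<^esub> = d"
proof -
  interpret comm_monoid "set_partition_monoid n" by (rule set_partition_comm_monoid)
  show "\<one>\<^bsub>set_partition_monoid n\<^esub> \<squnion>\<^bsub>set_partition_order n\<^esub> d = d"
    "d \<squnion>\<^bsub>set_partition_order n\<^esub> \<one>\<^bsub>set_partition_monoid n\<^esub> = d"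
    using l_one[of d] r_one[of d] assms by (simp_all add: set_partition_monoid_def)
qed

text \<open>Multiplying \<open>(d, s)\<close> by \<open>s\<^sup>-\<^sup>1 t\<close> on the right changes \<open>s\<close> into any \<open>t\<close>, which yields the
  product form. Multiplying \<open>(d, 1)\<close> by \<open>s\<close> on the left gives \<open>(s d, s)\<close>, hence invariance.\<close>

lemma submonoid_eq_Times:
  assumes M: "submonoid M (tied_symmetric_monoid n)" and sym: "embedded_sym n \<subseteq> M"
  obtains E where "join_invariant n E" "M = E \<times> {s. s permutes {1..n}}"
proof
  interpret submonoid M "tied_symmetric_monoid n" by (rule M)
  let ?T = "tied_symmetric_monoid n"
  define E where "E = fst ` M"
  have carr: "d \<in> carrier (set_partition_order n)" "s permutes {1..n}" if "(d, s) \<in> M" for d s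
    using subset that by (auto simp: tied_symmetric_monoid_sel)
  have perm: "(\<one>\<^bsub>set_partition_monoid n\<^esub>, s) \<in> M" if "s permutes {1..n}" for s
    using sym that by (auto simp: embedded_sym_def sym_group_def)
  have all_perms: "(d, t) \<in> M" if ds: "(d, s) \<in> M" and t: "t permutes {1..n}" for d s t
  proof -
    have s: "s permutes {1..n}" using carr ds by blast
    have inv: "Hilbert_Choice.inv s \<circ> t permutes {1..n}"
      using s t by (intro permutes_compose permutes_inv)
    have "(d, s) \<otimes>\<^bsub>?T\<^esub> (\<one>\<^bsub>set_partition_monoid n\<^esub>, Hilbert_Choice.inv s \<circ> t) \<in> M"
      using ds perm[OF inv] by (rule m_closed)
    moreover have "s \<circ> (Hilbert_Choice.inv s \<circ> t) = t"
      using permutes_inv_o(1)[OF s] by (metis comp_assoc id_comp)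
    moreover have "perm_act s \<one>\<^bsub>set_partition_monoid n\<^esub> = \<one>\<^bsub>set_partition_monoid n\<^esub>"
      using s perm_act_one by (simp add: sym_group_def)
    ultimately show ?thesis using carr(1)[OF ds] by (simp add: tied_symmetric_monoid_sel one_join)
  qed
  have mem: "d \<in> E \<longleftrightarrow> (d, t) \<in> M" if "t permutes {1..n}" for d t
    using that all_perms by (force simp: E_def)
  have "(d, s) \<in> M \<longleftrightarrow> d \<in> E \<and> s permutes {1..n}" for d s using mem carr by blast
  then show "M = E \<times> {s. s permutes {1..n}}" by auto
  show "join_invariant n E"
    unfolding join_invariant_def
  proof (intro conjI ballI allI impI)
    show "E \<subseteq> carrier (set_partition_order n)" using carr by (auto simp: E_def)
    fix d assume d: "d \<in> E"
    have dM: "(d, id) \<in> M" using d mem permutes_id by blast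
    show "d \<squnion>\<^bsub>set_partition_order n\<^esub> e \<in> E" if "e \<in> E" for e
    proof -
      have "(e, id) \<in> M" using that mem permutes_id by blast
      then have "(d, id) \<otimes>\<^bsub>?T\<^esub> (e, id) \<in> M" by (rule m_closed[OF dM])
      then show ?thesis by (force simp: tied_symmetric_monoid_sel perm_act_id E_def)
    qed
    show "perm_act s d \<in> E" if s: "s permutes {1..n}" for s
    proof -
      have "(\<one>\<^bsub>set_partition_monoid n\<^esub>, s) \<otimes>\<^bsub>?T\<^esub> (d, id) \<in> M" using perm[OF s] dM by (rule m_closed)
      then have "(perm_act s d, s) \<in> M"
        using perm_act_closed[OF s carr(1)[OF dM]] by (simp add: tied_symmetric_monoid_sel one_join)
      then show ?thesis by (force simp: E_def)
    qed
  qed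
qed

lemma submonoid_Un:
  assumes M1: "submonoid M1 (tied_symmetric_monoid n)" "embedded_sym n \<subseteq> M1"
    and M2: "submonoid M2 (tied_symmetric_monoid n)" "embedded_sym n \<subseteq> M2"
  shows "submonoid (M1 \<union> M2) (tied_symmetric_monoid n)"
proof -
  interpret M1: submonoid M1 "tied_symmetric_monoid n" by (rule M1)
  interpret M2: submonoid M2 "tied_symmetric_monoid n" by (rule M2)
  obtain E1 where E1: "join_invariant n E1" "M1 = E1 \<times> {s. s permutes {1..n}}"
    using submonoid_eq_Times[OF M1] .
  obtain E2 where E2: "join_invariant n E2" "M2 = E2 \<times> {s. s permutes {1..n}}"
    using submonoid_eq_Times[OF M2] .
  have mixed: "x \<otimes>\<^bsub>tied_symmetric_monoid n\<^esub> y \<in> (E \<union> E') \<times> {s. s permutes {1..n}}"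
    if E: "join_invariant n E" and E': "join_invariant n E'"
      and x: "x \<in> E \<times> {s. s permutes {1..n}}" and y: "y \<in> E' \<times> {s. s permutes {1..n}}"
    for E E' x y
  proof -
    obtain d s e t where xy: "x = (d, s)" "y = (e, t)" by fastforce
    have mem: "d \<in> E" "s permutes {1..n}" "e \<in> E'" "t permutes {1..n}" using x y xy by auto
    then have "perm_act s e \<in> E'" using E' by (simp add: join_invariant_def)
    then have "d \<squnion>\<^bsub>set_partition_order n\<^esub> perm_act s e \<in> E \<union> E'"
      by (rule join_mem_Un[OF E E' mem(1)])
    then show ?thesis
      using permutes_compose[OF mem(4,2)] by (simp add: xy tied_symmetric_monoid_sel)
  qed
  show ?thesis
  proof
    show "M1 \<union> M2 \<subseteq> carrier (tied_symmetric_monoid n)" using M1.subset M2.subset by blast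
    show "\<one>\<^bsub>tied_symmetric_monoid n\<^esub> \<in> M1 \<union> M2" by simp
    fix x y assume "x \<in> M1 \<union> M2" "y \<in> M1 \<union> M2"
    then consider "x \<in> M1" "y \<in> M1" | "x \<in> M2" "y \<in> M2" | "x \<in> M1" "y \<in> M2" | "x \<in> M2" "y \<in> M1"
      by blast
    then show "x \<otimes>\<^bsub>tied_symmetric_monoid n\<^esub> y \<in> M1 \<union> M2"
    proof cases
      case 3
      then show ?thesis using mixed[OF E1(1) E2(1), of x y] by (simp add: E1(2) E2(2) Sigma_Un_distrib1)
    next
      case 4
      then show ?thesis
        using mixed[OF E2(1) E1(1), of x y] by (simp add: E1(2) E2(2) Sigma_Un_distrib1 Un_commute)
    qed (use M1.m_closed M2.m_closed in simp_all)
  qed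
qed

lemma submonoid_Int: "submonoid A G \<Longrightarrow> submonoid B G \<Longrightarrow> submonoid (A \<inter> B) G"
  by (auto simp: submonoid_def)

theorem theorem1p1:
  fixes n :: nat
  assumes "0 < n"
  shows "(\<forall>M1 M2.
            submonoid M1 (tied_symmetric_monoid n) \<and> embedded_sym n \<subseteq> M1 \<and>
            submonoid M2 (tied_symmetric_monoid n) \<and> embedded_sym n \<subseteq> M2 \<longrightarrow>
            submonoid (M1 \<union> M2) (tied_symmetric_monoid n)) \<and>
         (let L = submonoids_containing (tied_symmetric_monoid n) (embedded_sym n) in
            distributive_lattice L \<and>
            (\<forall>M1\<in>carrier L. \<forall>M2\<in>carrier L.
               M1 \<squnion>\<^bsub>L\<^esub> M2 = M1 \<union> M2 \<and> M1 \<sqinter>\<^bsub>L\<^esub> M2 = M1 \<inter> M2))"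
proof -
  let ?T = "tied_symmetric_monoid n"
  let ?\<F> = "{M. submonoid M ?T \<and> embedded_sym n \<subseteq> M}"
  have Un: "A \<union> B \<in> ?\<F>" if "A \<in> ?\<F>" "B \<in> ?\<F>" for A B
    using that submonoid_Un by auto
  have Int: "A \<inter> B \<in> ?\<F>" if "A \<in> ?\<F>" "B \<in> ?\<F>" for A B
    using that submonoid_Int by auto
  have L: "submonoids_containing ?T (embedded_sym n) = \<lparr>carrier = ?\<F>, eq = (=), le = (\<subseteq>)\<rparr>"
    by (simp add: submonoids_containing_def)
  have carrier: "carrier (submonoids_containing ?T (embedded_sym n)) = ?\<F>"
    by (simp add: L)
  have lat: "distributive_lattice (submonoids_containing ?T (embedded_sym n))"
    unfolding L by (rule lattice_of_sets(1)) (fact Un Int)+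
  have join: "A \<squnion>\<^bsub>submonoids_containing ?T (embedded_sym n)\<^esub> B = A \<union> B"
    if "A \<in> ?\<F>" "B \<in> ?\<F>" for A B
    unfolding L by (rule lattice_of_sets(2)) (fact Un Int that)+
  have meet: "A \<sqinter>\<^bsub>submonoids_containing ?T (embedded_sym n)\<^esub> B = A \<inter> B"
    if "A \<in> ?\<F>" "B \<in> ?\<F>" for A B
    unfolding L by (rule lattice_of_sets(3)) (fact Un Int that)+
  show ?thesis
    unfolding Let_def carrier
  proof (intro conjI allI impI ballI)
    fix M1 M2
    assume "submonoid M1 ?T \<and> embedded_sym n \<subseteq> M1 \<and> submonoid M2 ?T \<and> embedded_sym n \<subseteq> M2"
    then show "submonoid (M1 \<union> M2) ?T" using submonoid_Un by blast
  qed (fact lat join meet)+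
qed

end
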